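(* For every $\rho\in\mathcal M_{++}$, the following statements are equivalent: (b1) $\mathcal T_{AB}(\rho)=\mathcal T_{MD}(\rho)$; (b2) $\Omega(\rho)-\nabla f(\rho)\in N_{\mathcal M}$.
   Context: $\mathcal H$ is a finite-dimensional complex Hilbert space, $\mathcal B(\mathcal H)$ the real space of Hermitian operators with inner product $\langle X,Y\rangle=\operatorname{Tr}(XY)$, $\mathcal S(\mathcal H)$ the set of density operators. $H_1,\dots,H_k\in\mathcal B(\mathcal H)$ and $c\in\mathbb R^k$ are given, with $\{I,H_1,\dots,H_k\}$ linearly independent, and $\mathcal M=\{\rho\in\mathcal S(\mathcal H):\operatorname{Tr}(\rho H_j)=c_j,\ j=1,\dots,k\}$ is assumed to contain a positive-definite state; $\mathcal M_{++}=\{\rho\in\mathcal M:\rho\succ0\}$. $T_{\mathcal M}=\{X\in\mathcal B(\mathcal H):\operatorname{Tr}X=0,\ \operatorname{Tr}(XH_j)=0\ \forall j\}$ and $N_{\mathcal M}=T_{\mathcal M}^\perp=\operatorname{span}\{I,H_1,\dots,H_k\}$. $\Omega:\mathcal S(\mathcal H)\to\mathcal B(\mathcal H)$ is continuous, $f(\rho)=\operatorname{Tr}[\rho\,\Omega(\rho)]$, and $\gamma>0$. $f$ is assumed differentiable relative to the affine hull of $\mathcal M$: $\nabla f(\rho)\in\mathcal B(\mathcal H)$ denotes an operator with $f(\sigma)=f(\rho)+\operatorname{Tr}[\nabla f(\rho)(\sigma-\rho)]+o(\|\sigma-\rho\|)$ as $\sigma\to\rho$ in $\mathcal M$ (determined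 up to adding elements of $N_{\mathcal M}$). $D(\sigma\|\rho)=\operatorname{Tr}\,\sigma(\log\sigma-\log\rho)$ (with $0\log0=0$). For $\rho\in\mathcal M_{++}$ the Arimoto–Blahut (AB) map is $\mathcal T_{AB}(\rho)=\arg\min_{\sigma\in\mathcal M}D(\sigma\|\mathcal F_3[\rho])$, where $\mathcal F_3[\rho]=\exp(\log\rho-\tfrac1\gamma\Omega(\rho))/\operatorname{Tr}\exp(\log\rho-\tfrac1\gamma\Omega(\rho))$, and the mirror-descent (MD) map is $\mathcal T_{MD}(\rho)=\arg\min_{\sigma\in\mathcal M}\{\operatorname{Tr}[\sigma\nabla f(\rho)]+\gamma D(\sigma\|\rho)\}$. *)

theory Defs
  imports "HOL-Analysis.Analysis"
begin

text \<open>Operators on the Hilbert space are matrices over \<open>complex ^ 'n\<close>, regarded as a real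
  vector space.\<close>

type_synonym 'n cmat = "complex ^ 'n ^ 'n"

definition adj :: "'n::finite cmat \<Rightarrow> 'n cmat" where
  "adj A = (\<chi> i j. cnj (A $ j $ i))"

definition Herm :: "'n::finite cmat set" where
  "Herm = {A. adj A = A}"

definition unitary :: "'n::finite cmat \<Rightarrow> bool" where
  "unitary U \<longleftrightarrow> adj U ** U = mat 1 \<and> U ** adj U = mat 1"

definition cinner :: "complex ^ 'n::finite \<Rightarrow> complex ^ 'n \<Rightarrow> complex" where
  "cinner v w = (\<Sum>i\<in>UNIV. cnj (v $ i) * w $ i)"

definition pos_semidef :: "'n::finite cmat \<Rightarrow> bool" where
  "pos_semidef A \<longleftrightarrow> A \<in> Herm \<and> (\<forall>v. 0 \<le> Re (cinner v (A *v v)))"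

definition pos_def :: "'n::finite cmat \<Rightarrow> bool" where
  "pos_def A \<longleftrightarrow> A \<in> Herm \<and> (\<forall>v. v \<noteq> 0 \<longrightarrow> 0 < Re (cinner v (A *v v)))"

text \<open>\<open>Tr(XY)\<close> is a real number for Hermitian \<open>X\<close>, \<open>Y\<close>, so taking the real part only
  changes the type.\<close>

definition hs_inner :: "'n::finite cmat \<Rightarrow> 'n cmat \<Rightarrow> real" where
  "hs_inner X Y = Re (trace (X ** Y))"

definition diag_mat :: "('n \<Rightarrow> real) \<Rightarrow> 'n::finite cmat" where
  "diag_mat d = (\<chi> i j. if i = j then complex_of_real (d i) else 0)"

text \<open>Functional calculus: \<open>g(U diag(d) U\<^sup>*) = U diag(g \<circ> d) U\<^sup>*\<close>. For Hermitian \<open>A\<close> such a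
  decomposition exists by the spectral theorem, and the result does not depend on its choice.\<close>

definition herm_fun :: "(real \<Rightarrow> real) \<Rightarrow> 'n::finite cmat \<Rightarrow> 'n cmat" where
  "herm_fun g A = (THE B. \<exists>U d. unitary U \<and> A = U ** diag_mat d ** adj U
                              \<and> B = U ** diag_mat (g \<circ> d) ** adj U)"

abbreviation mexp :: "'n::finite cmat \<Rightarrow> 'n cmat" where
  "mexp \<equiv> herm_fun exp"

abbreviation mlog :: "'n::finite cmat \<Rightarrow> 'n cmat" where
  "mlog \<equiv> herm_fun ln"

definition density_ops :: "'n::finite cmat set" where
  "density_ops = {\<rho>. pos_semidef \<rho> \<and> trace \<rho> = 1}"

text \<open>Used for a density operator \<open>\<sigma>\<close> and a positive definite \<open>\<rho>\<close>, where the relative entropy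
  is finite. Since \<open>ln 0 = 0\<close>, zero eigenvalues of \<open>\<sigma>\<close> contribute \<open>0 log 0 = 0\<close>.\<close>

definition rel_entropy :: "'n::finite cmat \<Rightarrow> 'n cmat \<Rightarrow> real" where
  "rel_entropy \<sigma> \<rho> = hs_inner \<sigma> (mlog \<sigma> - mlog \<rho>)"

text \<open>Constraint operators are \<open>H 1, \<dots>, H k\<close>, with prescribed values \<open>c 1, \<dots>, c k\<close>.\<close>

definition feasible :: "(nat \<Rightarrow> 'n::finite cmat) \<Rightarrow> (nat \<Rightarrow> real) \<Rightarrow> nat \<Rightarrow> 'n cmat set" where
  "feasible H c k = {\<rho> \<in> density_ops. \<forall>j\<in>{1..k}. hs_inner \<rho> (H j) = c j}"

definition feasible_pos :: "(nat \<Rightarrow> 'n::finite cmat) \<Rightarrow> (nat \<Rightarrow> real) \<Rightarrow> nat \<Rightarrow> 'n cmat set" where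
  "feasible_pos H c k = {\<rho> \<in> feasible H c k. pos_def \<rho>}"

definition T_space :: "(nat \<Rightarrow> 'n::finite cmat) \<Rightarrow> nat \<Rightarrow> 'n cmat set" where
  "T_space H k = {X \<in> Herm. trace X = 0 \<and> (\<forall>j\<in>{1..k}. hs_inner X (H j) = 0)}"

definition N_space :: "(nat \<Rightarrow> 'n::finite cmat) \<Rightarrow> nat \<Rightarrow> 'n cmat set" where
  "N_space H k = {Y \<in> Herm. \<forall>X\<in>T_space H k. hs_inner Y X = 0}"

definition objective :: "('n::finite cmat \<Rightarrow> 'n cmat) \<Rightarrow> 'n cmat \<Rightarrow> real" where
  "objective \<Omega> \<rho> = hs_inner \<rho> (\<Omega> \<rho>)"

definition F3 :: "('n::finite cmat \<Rightarrow> 'n cmat) \<Rightarrow> real \<Rightarrow> 'n cmat \<Rightarrow> 'n cmat" where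
  "F3 \<Omega> \<gamma> \<rho> = (let E = mexp (mlog \<rho> - (1 / \<gamma>) *\<^sub>R \<Omega> \<rho>) in (1 / Re (trace E)) *\<^sub>R E)"

text \<open>In both maps the function to be minimised is continuous and strictly convex on the compact
  convex set \<open>M\<close> (for positive definite \<open>\<rho>\<close> and \<open>\<gamma> > 0\<close>), so the minimiser exists and is
  unique.\<close>

definition T_AB :: "'n::finite cmat set \<Rightarrow> ('n cmat \<Rightarrow> 'n cmat) \<Rightarrow> real \<Rightarrow> 'n cmat \<Rightarrow> 'n cmat" where
  "T_AB M \<Omega> \<gamma> \<rho> = arg_min_on (\<lambda>\<sigma>. rel_entropy \<sigma> (F3 \<Omega> \<gamma> \<rho>)) M"

definition T_MD :: "'n::finite cmat set \<Rightarrow> ('n cmat \<Rightarrow> 'n cmat) \<Rightarrow> real \<Rightarrow> 'n cmat \<Rightarrow> 'n cmat" where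
  "T_MD M grad \<gamma> \<rho> = arg_min_on (\<lambda>\<sigma>. hs_inner \<sigma> (grad \<rho>) + \<gamma> * rel_entropy \<sigma> \<rho>) M"

text \<open>\<open>G\<close> is a gradient of \<open>f\<close> at \<open>\<rho>\<close> relative to \<open>M\<close>; it is determined only up to adding
  elements of the normal space.\<close>

definition is_gradient :: "('n::finite cmat \<Rightarrow> real) \<Rightarrow> 'n cmat set \<Rightarrow> 'n cmat \<Rightarrow> 'n cmat \<Rightarrow> bool" where
  "is_gradient f M \<rho> G \<longleftrightarrow>
     G \<in> Herm \<and> (f has_derivative (\<lambda>X. hs_inner G X)) (at \<rho> within M)"

end

theory Submission
  imports Defs
begin

text \<open>On the feasible set \<open>M\<close> both objectives are, up to a positive factor and an additive
  constant, of the form \<open>Tr (\<sigma> log \<sigma>) + Tr (\<sigma> C)\<close>, with \<open>C = \<Omega>(\<rho>)/\<gamma> - log \<rho>\<close> for the AB map and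
  \<open>C = \<nabla>f(\<rho>)/\<gamma> - log \<rho>\<close> for the MD map. If the two operators \<open>C\<close> differ by an element of the
  normal space, the objectives differ by a constant on \<open>M\<close>. Conversely, a minimiser \<open>\<sigma>\<close> exists by
  compactness, is positive definite because the entropy has infinite slope at the boundary, and
  hence satisfies \<open>Tr (X (log \<sigma> + C)) = 0\<close> for all tangent \<open>X\<close>; subtracting the two conditions
  at a common minimiser gives the claim. Derivatives of the entropy are avoided: Klein's inequality
  \<open>D(\<sigma>\<parallel>\<tau>) \<ge> 0\<close> turns minimality of \<open>\<sigma>\<close> into \<open>Tr ((\<tau> - \<sigma>) (log \<tau> + C)) \<ge> 0\<close> for positive definite
  \<open>\<tau>\<close>, and the rest follows from continuity of the functional calculus.\<close>

section \<open>Matrix algebra\<close>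

lemma adj_adj [simp]: "adj (adj A) = A"
  by (simp add: adj_def vec_eq_iff)

lemma adj_mult: "adj (A ** B) = adj B ** adj A"
  by (simp add: adj_def matrix_matrix_mult_def vec_eq_iff mult.commute)

lemma adj_add: "adj (A + B) = adj A + adj B"
  by (simp add: adj_def vec_eq_iff)

lemma adj_diff: "adj (A - B) = adj A - adj B"
  by (simp add: adj_def vec_eq_iff)

lemma adj_scaleR: "adj (r *\<^sub>R A) = r *\<^sub>R adj A"
  by (simp add: adj_def vec_eq_iff complex_cnj_scaleR)

lemma adj_diag_mat [simp]: "adj (diag_mat d) = diag_mat d"
  by (simp add: adj_def diag_mat_def vec_eq_iff)

lemma Herm_add: "A \<in> Herm \<Longrightarrow> B \<in> Herm \<Longrightarrow> A + B \<in> Herm"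
  by (simp add: Herm_def adj_add)

lemma Herm_diff: "A \<in> Herm \<Longrightarrow> B \<in> Herm \<Longrightarrow> A - B \<in> Herm"
  by (simp add: Herm_def adj_diff)

lemma Herm_scaleR: "A \<in> Herm \<Longrightarrow> r *\<^sub>R A \<in> Herm"
  by (simp add: Herm_def adj_scaleR)

lemma diag_mat_mult_left: "(diag_mat d ** A) $ i $ j = of_real (d i) * A $ i $ j"
  by (simp add: matrix_matrix_mult_def diag_mat_def if_distrib[where f = "\<lambda>x. x * _"] cong: if_cong)

lemma diag_mat_mult_right: "(A ** diag_mat d) $ i $ j = A $ i $ j * of_real (d j)"
  by (simp add: matrix_matrix_mult_def diag_mat_def if_distrib[where f = "\<lambda>x. _ * x"] cong: if_cong)

lemma diag_mat_mult: "diag_mat d ** diag_mat e = diag_mat (\<lambda>i. d i * e i)"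
  by (simp add: vec_eq_iff diag_mat_mult_left) (simp add: diag_mat_def)

lemma unitary_adj: "unitary U \<Longrightarrow> unitary (adj U)"
  by (simp add: unitary_def)

lemma unitary_mult:
  assumes "unitary U" "unitary V"
  shows "unitary (U ** V)"
proof -
  have "adj (U ** V) ** (U ** V) = adj V ** (adj U ** U) ** V"
    by (simp add: adj_mult matrix_mul_assoc)
  moreover have "(U ** V) ** adj (U ** V) = U ** (V ** adj V) ** adj U"
    by (simp add: adj_mult matrix_mul_assoc)
  ultimately show ?thesis
    using assms by (simp add: unitary_def)
qed

lemma unitary_row_sum:
  assumes "unitary U"
  shows "(\<Sum>j\<in>UNIV. (cmod (U $ i $ j))\<^sup>2) = 1"
proof -
  have "(U ** adj U) $ i $ i = 1"
    using assms by (simp add: unitary_def mat_def)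
  then have "complex_of_real (\<Sum>j\<in>UNIV. (cmod (U $ i $ j))\<^sup>2) = 1"
    by (simp add: matrix_matrix_mult_def adj_def complex_norm_square del: of_real_power)
  then show ?thesis
    by (simp only: of_real_eq_1_iff)
qed

lemma unitary_column_sum:
  assumes "unitary U"
  shows "(\<Sum>i\<in>UNIV. (cmod (U $ i $ j))\<^sup>2) = 1"
  using unitary_row_sum[OF unitary_adj[OF assms], of j] by (simp add: adj_def)

lemma cinner_inner: "Re (cinner v w) = v \<bullet> w"
  by (simp add: cinner_def inner_vec_def inner_complex_def)

lemma cinner_adj: "cinner v (A *v w) = cinner (adj A *v v) w"
proof -
  have "cinner v (A *v w) = (\<Sum>i\<in>UNIV. \<Sum>j\<in>UNIV. cnj (v $ i) * A $ i $ j * w $ j)"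
    by (simp add: cinner_def matrix_vector_mult_def sum_distrib_left mult.assoc)
  also have "\<dots> = (\<Sum>j\<in>UNIV. \<Sum>i\<in>UNIV. cnj (v $ i) * A $ i $ j * w $ j)"
    by (rule sum.swap)
  also have "\<dots> = cinner (adj A *v v) w"
    by (simp add: cinner_def matrix_vector_mult_def adj_def sum_distrib_right sum_distrib_left
        mult.commute mult.left_commute)
  finally show ?thesis .
qed

lemma cinner_commute: "cinner v w = cnj (cinner w v)"
  by (simp add: cinner_def mult.commute)

lemma cinner_add_right: "cinner v (x + y) = cinner v x + cinner v y"
  by (simp add: cinner_def algebra_simps sum.distrib)

lemma cinner_scaleR_right: "cinner v (r *\<^sub>R x) = r *\<^sub>R cinner v x"
  by (simp add: cinner_def scaleR_sum_right)

lemma cinner_scaleR_left: "cinner (r *\<^sub>R v) x = r *\<^sub>R cinner v x"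
  by (subst (1 2) cinner_commute) (simp add: cinner_scaleR_right complex_cnj_scaleR)

lemma cinner_self: "cinner v v = of_real ((norm v)\<^sup>2)"
proof (rule complex_eqI)
  show "Re (cinner v v) = Re (of_real ((norm v)\<^sup>2))"
    by (simp only: cinner_inner power2_norm_eq_inner Re_complex_of_real)
  show "Im (cinner v v) = Im (of_real ((norm v)\<^sup>2))"
    using arg_cong[OF cinner_commute[of v v], of Im] by simp
qed

section \<open>The spectral theorem\<close>

text \<open>A maximiser \<open>v\<close> of the Rayleigh quotient over the unit sphere of
  \<open>V\<close> is an eigenvector. The form \<open>q\<close> is nonnegative on \<open>V\<close>
  and vanishes at \<open>v\<close>, so moving from \<open>v\<close> along the residual
  \<open>w\<close> changes it by \<open>2 * t * (w \<bullet> w) + t\<^sup>2 * q w\<close>. For small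
  negative \<open>t\<close> this is negative unless \<open>w = 0\<close>.\<close>

lemma self_adjoint_eigenvector:
  fixes f :: "'a::euclidean_space \<Rightarrow> 'a"
  assumes lin: "linear f" and sym: "\<And>x y. x \<bullet> f y = f x \<bullet> y"
    and V: "subspace V" "f ` V \<subseteq> V" and ne: "z \<in> V" "z \<noteq> 0"
  obtains v l where "v \<in> V" "norm v = 1" "f v = l *\<^sub>R v"
proof -
  let ?S = "sphere 0 1 \<inter> V"
  have "compact ?S"
    by (intro compact_Int_closed compact_sphere closed_subspace V)
  moreover have "(1 / norm z) *\<^sub>R z \<in> ?S"
    using ne V(1) by (simp add: subspace_scale)
  then have "?S \<noteq> {}" by blast
  moreover have "continuous_on ?S (\<lambda>x. x \<bullet> f x)"
    by (intro continuous_intros linear_continuous_on linear_linear[THEN iffD2] lin)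
  ultimately obtain v where v: "v \<in> ?S" and vmax: "\<And>x. x \<in> ?S \<Longrightarrow> x \<bullet> f x \<le> v \<bullet> f v"
    using continuous_attains_sup[of ?S "\<lambda>x. x \<bullet> f x"] by metis
  define l where "l = v \<bullet> f v"
  define q where "q x = l * (x \<bullet> x) - x \<bullet> f x" for x
  have q_nonneg: "0 \<le> q x" if "x \<in> V" for x
  proof (cases "x = 0")
    case True
    then show ?thesis by (simp add: q_def)
  next
    case False
    have "(1 / norm x) *\<^sub>R x \<in> ?S"
      using False that V(1) by (simp add: subspace_scale)
    from vmax[OF this] have "(x \<bullet> f x) / (norm x)\<^sup>2 \<le> l"
      by (simp add: l_def linear_scale[OF lin] power2_eq_square)
    then show ?thesis
      using False by (simp add: q_def divide_le_eq power2_norm_eq_inner)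
  qed
  define w where "w = l *\<^sub>R v - f v"
  have "w \<in> V"
    using v V by (auto simp: w_def intro!: subspace_diff subspace_scale)
  have "v \<bullet> v = 1" using v by (simp add: dot_square_norm)
  have expand: "q (v + t *\<^sub>R w) = 2 * t * (w \<bullet> w) + t\<^sup>2 * q w" for t
  proof -
    have ww: "w \<bullet> w = l * (w \<bullet> v) - w \<bullet> f v"
      by (subst (2) w_def) (simp add: inner_diff_right)
    have "v \<bullet> f w = w \<bullet> f v"
      using sym[of v w] by (simp add: inner_commute)
    then have "q (v + t *\<^sub>R w) = 2 * t * (l * (w \<bullet> v) - w \<bullet> f v) + t\<^sup>2 * q w"
      using \<open>v \<bullet> v = 1\<close>
      by (simp add: q_def linear_add[OF lin] linear_scale[OF lin] inner_add_left inner_add_right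
          l_def[symmetric] power2_eq_square inner_commute[of v w] algebra_simps)
    then show ?thesis by (simp only: ww)
  qed
  have "w = 0"
  proof (rule ccontr)
    assume "w \<noteq> 0"
    define a b where "a = w \<bullet> w" and "b = q w"
    have ab: "a > 0" "b \<ge> 0"
      using \<open>w \<noteq> 0\<close> q_nonneg[OF \<open>w \<in> V\<close>] by (auto simp: a_def b_def)
    \<comment> \<open>Small enough that the quadratic term cannot outweigh the linear one:
      \<open>t * b \<ge> - a\<close>. The \<open>+ 1\<close> keeps the divisor positive when
      \<open>b = 0\<close>.\<close>
    define t where "t = - (a / (b + 1))"
    have "t < 0" using ab by (simp add: t_def)
    have "t * b \<ge> - a"
      using ab by (simp add: t_def field_simps)
    then have "2 * a + t * b > 0" using ab by linarith
    then have "t * (2 * a + t * b) < 0"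
      using \<open>t < 0\<close> by (simp add: mult_neg_pos)
    moreover have "0 \<le> q (v + t *\<^sub>R w)"
      using v V(1) \<open>w \<in> V\<close> by (intro q_nonneg) (auto intro: subspace_add subspace_scale)
    ultimately show False
      unfolding expand a_def[symmetric] b_def[symmetric] by (simp add: power2_eq_square algebra_simps)
  qed
  then have "f v = l *\<^sub>R v" by (simp add: w_def)
  with v that show ?thesis by auto
qed

text \<open>Induction on the index set: the orthogonal complement \<open>V\<close> of the
  eigenvectors found so far is invariant under \<open>A\<close>, so the previous result supplies
  another eigenvector inside \<open>V\<close>.\<close>

lemma Herm_orthonormal_eigenvectors:
  fixes A :: "'n::finite cmat" and J :: "'n set"
  assumes A: "A \<in> Herm"
  shows "\<exists>u d. \<forall>i\<in>J. A *v u i = d i *\<^sub>R u i \<and> (\<forall>j\<in>J. cinner (u i) (u j) = (if i = j then 1 else 0))"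
  using finite[of J]
proof (induction J)
  case empty
  then show ?case by simp
next
  case (insert a J)
  then obtain u d where
    eig: "\<And>i. i \<in> J \<Longrightarrow> A *v u i = d i *\<^sub>R u i" and
    orth: "\<And>i j. i \<in> J \<Longrightarrow> j \<in> J \<Longrightarrow> cinner (u i) (u j) = (if i = j then 1 else 0)"
    by metis
  define V where "V = {v. \<forall>j\<in>J. cinner (u j) v = 0}"
  \<comment> \<open>The kernel of \<open>B\<close> is exactly \<open>V\<close>. As
    \<open>a \<notin> J\<close>, row \<open>a\<close> is zero, so \<open>B\<close> is singular and
    \<open>V\<close> contains a nonzero vector.\<close>
  define B :: "'n cmat" where "B = (\<chi> i. if i \<in> J then (\<chi> m. cnj (u i $ m)) else 0)"
  have "row a B = 0"
    using insert.hyps by (simp add: row_def B_def vec_eq_iff)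
  then have "det B = 0" by (rule det_zero_row)
  then have "\<not> invertible B" by (simp add: invertible_det_nz)
  then obtain z where z: "B *v z = 0" "z \<noteq> 0"
    using invertible_left_inverse[of B] matrix_left_invertible_ker[of B] by blast
  have "cinner (u j) z = (B *v z) $ j" if "j \<in> J" for j
    using that by (simp add: matrix_vector_mult_def B_def cinner_def)
  then have "z \<in> V" using z by (simp add: V_def)
  have adjA: "adj A = A" using A by (simp add: Herm_def)
  have "subspace V"
    by (auto simp: subspace_def V_def cinner_add_right cinner_scaleR_right) (simp add: cinner_def)
  moreover have "(*v) A ` V \<subseteq> V"
    by (auto simp: V_def cinner_adj[of _ A] adjA eig cinner_scaleR_left)
  moreover have "x \<bullet> (A *v y) = (A *v x) \<bullet> y" for x y
    using arg_cong[OF cinner_adj[of x A y], of Re] by (simp only: cinner_inner adjA)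
  moreover have "linear ((*v) A)"
    by (rule linearI, simp add: matrix_vector_right_distrib)
      (simp add: vec_eq_iff matrix_vector_mult_def scaleR_sum_right)
  ultimately obtain v l where v: "v \<in> V" "norm v = 1" "A *v v = l *\<^sub>R v"
    using self_adjoint_eigenvector[of "(*v) A" V z] \<open>z \<in> V\<close> z(2) by metis
  have "cinner v (u j) = 0" if "j \<in> J" for j
    using v(1) that cinner_commute[of v "u j"] by (simp add: V_def)
  moreover have "cinner v v = 1"
    using v(2) by (simp add: cinner_self)
  ultimately have "\<forall>i\<in>insert a J. A *v (u(a := v)) i = (d(a := l)) i *\<^sub>R (u(a := v)) i \<and>
      (\<forall>j\<in>insert a J. cinner ((u(a := v)) i) ((u(a := v)) j) = (if i = j then 1 else 0))"
    using insert.hyps v eig orth by (auto simp: V_def)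
  then show ?case by blast
qed

theorem Herm_spectral:
  fixes A :: "'n::finite cmat"
  assumes "A \<in> Herm"
  obtains U d where "unitary U" "A = U ** diag_mat d ** adj U"
proof -
  obtain u :: "'n \<Rightarrow> complex ^ 'n" and d :: "'n \<Rightarrow> real" where ud: "\<forall>i. A *v u i = d i *\<^sub>R u i \<and> (\<forall>j. cinner (u i) (u j) = (if i = j then 1 else 0))"
    using Herm_orthonormal_eigenvectors[OF assms, of UNIV] by auto
  then have eig: "A *v u i = d i *\<^sub>R u i"
    and orth: "cinner (u i) (u j) = (if i = j then 1 else 0)" for i j
    by auto
  define U :: "'n cmat" where "U = (\<chi> i j. u j $ i)"
  have "(adj U ** U) $ i $ j = cinner (u i) (u j)" for i j
    by (simp add: matrix_matrix_mult_def adj_def U_def cinner_def)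
  then have left: "adj U ** U = mat 1"
    by (simp add: vec_eq_iff mat_def orth)
  then have right: "U ** adj U = mat 1"
    by (simp add: matrix_left_right_inverse)
  have "(A ** U) $ i $ j = (A *v u j) $ i" for i j
    by (simp add: matrix_matrix_mult_def matrix_vector_mult_def U_def)
  then have "A ** U = U ** diag_mat d"
    by (simp add: vec_eq_iff diag_mat_mult_right eig) (simp add: U_def scaleR_conv_of_real mult.commute)
  then have "A = U ** diag_mat d ** adj U"
    by (metis right matrix_mul_assoc matrix_mul_rid)
  with left right show ?thesis by (intro that[of U d]) (simp_all add: unitary_def)
qed

section \<open>Functional calculus\<close>

definition udiag :: "'n::finite cmat \<Rightarrow> ('n \<Rightarrow> real) \<Rightarrow> 'n cmat" where
  "udiag U d = U ** diag_mat d ** adj U"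

text \<open>The Hermitian matrices with spectrum in \<open>S\<close>, presented through
  diagonalisations so that compactness of \<open>S\<close> carries over from the parameters.\<close>

definition spec_in :: "real set \<Rightarrow> 'n::finite cmat set" where
  "spec_in S = {udiag U d | U d. unitary U \<and> range d \<subseteq> S}"

lemma udiag_nth: "udiag U d $ i $ j = (\<Sum>k\<in>UNIV. U $ i $ k * of_real (d k) * cnj (U $ j $ k))"
  unfolding udiag_def by (subst matrix_matrix_mult_def) (simp add: diag_mat_mult_right adj_def)

lemma udiag_Herm: "udiag U d \<in> Herm"
  by (simp add: Herm_def udiag_def adj_mult matrix_mul_assoc)

lemma spec_in_Herm: "A \<in> spec_in S \<Longrightarrow> A \<in> Herm"
  by (auto simp: spec_in_def udiag_Herm)

lemma spec_in_mono: "S \<subseteq> T \<Longrightarrow> spec_in S \<subseteq> spec_in T"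
  unfolding spec_in_def by blast

lemma Herm_udiag:
  assumes "A \<in> Herm"
  obtains U d where "unitary U" "A = udiag U d"
  using Herm_spectral[OF assms] unfolding udiag_def by blast

lemma udiag_mult:
  assumes "unitary U"
  shows "udiag U d ** udiag U e = udiag U (\<lambda>i. d i * e i)"
proof -
  have "udiag U d ** udiag U e = U ** diag_mat d ** (adj U ** U) ** diag_mat e ** adj U"
    by (simp add: udiag_def matrix_mul_assoc)
  also have "\<dots> = U ** (diag_mat d ** diag_mat e) ** adj U"
    using assms by (simp add: unitary_def matrix_mul_assoc)
  finally show ?thesis
    by (simp add: udiag_def diag_mat_mult)
qed

lemma udiag_add: "udiag U d + udiag U e = udiag U (\<lambda>i. d i + e i)"
  by (simp add: vec_eq_iff udiag_nth sum.distrib[symmetric] algebra_simps)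

lemma udiag_scaleR: "r *\<^sub>R udiag U d = udiag U (\<lambda>i. r * d i)"
  by (simp add: vec_eq_iff udiag_nth scaleR_sum_right) (simp add: scaleR_conv_of_real algebra_simps)

lemma udiag_const:
  assumes "unitary U"
  shows "udiag U (\<lambda>_. r) = r *\<^sub>R mat 1"
proof -
  have "udiag U (\<lambda>_. r) = r *\<^sub>R (U ** adj U)"
    by (simp add: vec_eq_iff udiag_nth matrix_matrix_mult_def adj_def scaleR_sum_right)
      (simp add: scaleR_conv_of_real algebra_simps)
  then show ?thesis using assms by (simp add: unitary_def)
qed

lemma trace_udiag:
  assumes "unitary U"
  shows "trace (udiag U d) = of_real (\<Sum>i\<in>UNIV. d i)"
proof -
  have "trace (udiag U d) = trace (adj U ** (U ** diag_mat d))"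
    unfolding udiag_def by (rule trace_mul_sym)
  also have "\<dots> = trace (diag_mat d)"
    using assms by (simp add: unitary_def matrix_mul_assoc)
  finally show ?thesis by (simp add: trace_def diag_mat_def)
qed

text \<open>The change of basis \<open>adj V ** U\<close> intertwines the two diagonal matrices.
  Comparing entries, it can only link indices that carry equal eigenvalues.\<close>

lemma udiag_intertwine:
  assumes U: "unitary U" and V: "unitary V" and eq: "udiag U d = udiag V e"
    and nz: "(adj V ** U) $ i $ j \<noteq> 0"
  shows "e i = d j"
proof -
  have "adj V ** U ** diag_mat d = adj V ** (U ** diag_mat d ** adj U) ** U"
    using U by (simp add: unitary_def flip: matrix_mul_assoc)
  also have "\<dots> = adj V ** (V ** diag_mat e ** adj V) ** U"
    using eq by (simp add: udiag_def)
  also have "\<dots> = (adj V ** V) ** diag_mat e ** (adj V ** U)"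
    by (simp add: matrix_mul_assoc)
  also have "\<dots> = diag_mat e ** (adj V ** U)"
    using V by (simp add: unitary_def)
  finally have "(adj V ** U ** diag_mat d) $ i $ j = (diag_mat e ** (adj V ** U)) $ i $ j"
    by simp
  then show ?thesis
    using nz by (simp add: diag_mat_mult_left diag_mat_mult_right mult.commute)
qed

text \<open>Since \<open>adj V ** U\<close> links only equal eigenvalues, it still intertwines the
  diagonals after \<open>g\<close> is applied to both. This is what makes the description in
  \<open>herm_fun\<close> well defined.\<close>

lemma udiag_fun_unique:
  assumes U: "unitary U" and V: "unitary V" and eq: "udiag U d = udiag V e"
  shows "udiag U (g \<circ> d) = udiag V (g \<circ> e)"
proof -
  have "(adj V ** U) $ i $ j * of_real (g (d j)) = of_real (g (e i)) * (adj V ** U) $ i $ j" for i j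
    using udiag_intertwine[OF U V eq, of i j] by (cases "(adj V ** U) $ i $ j = 0") auto
  then have *: "adj V ** U ** diag_mat (g \<circ> d) = diag_mat (g \<circ> e) ** (adj V ** U)"
    by (simp add: vec_eq_iff diag_mat_mult_left diag_mat_mult_right)
  have "udiag U (g \<circ> d) = (V ** adj V) ** (U ** diag_mat (g \<circ> d)) ** adj U"
    using V by (simp add: udiag_def unitary_def)
  also have "\<dots> = V ** (adj V ** U ** diag_mat (g \<circ> d)) ** adj U"
    by (simp add: matrix_mul_assoc)
  also have "\<dots> = V ** diag_mat (g \<circ> e) ** adj V ** (U ** adj U)"
    by (simp add: * matrix_mul_assoc)
  also have "\<dots> = udiag V (g \<circ> e)"
    using U by (simp add: unitary_def udiag_def)
  finally show ?thesis .
qed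

lemma herm_fun_udiag:
  assumes "unitary U"
  shows "herm_fun g (udiag U d) = udiag U (g \<circ> d)"
  unfolding herm_fun_def udiag_def[symmetric]
proof (rule the_equality)
  show "\<exists>U' d'. unitary U' \<and> udiag U d = udiag U' d' \<and> udiag U (g \<circ> d) = udiag U' (g \<circ> d')"
    using assms by blast
next
  fix B
  assume "\<exists>U' d'. unitary U' \<and> udiag U d = udiag U' d' \<and> B = udiag U' (g \<circ> d')"
  then show "B = udiag U (g \<circ> d)"
    using udiag_fun_unique[OF assms] by metis
qed

lemma herm_fun_Herm:
  assumes "A \<in> Herm"
  shows "herm_fun g A \<in> Herm"
  using Herm_udiag[OF assms] by (metis herm_fun_udiag udiag_Herm)

section \<open>Spectra and quadratic forms\<close>

lemma unitary_mult_vec: "unitary U \<Longrightarrow> adj U *v (U *v v) = v"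
  by (simp add: unitary_def matrix_vector_mul_assoc)

lemma quad_udiag:
  "v \<bullet> (udiag U d *v v) = (\<Sum>i\<in>UNIV. d i * (cmod ((adj U *v v) $ i))\<^sup>2)"
proof -
  let ?w = "adj U *v v"
  have diag: "(diag_mat d *v ?w) $ i = d i *\<^sub>R ?w $ i" for i
    by (subst matrix_vector_mult_def)
      (simp add: diag_mat_def if_distrib[where f = "\<lambda>x. x * _"] scaleR_conv_of_real cong: if_cong)
  have "v \<bullet> (udiag U d *v v) = v \<bullet> (U *v (diag_mat d *v ?w))"
    by (simp add: udiag_def matrix_vector_mul_assoc matrix_mul_assoc)
  also have "\<dots> = ?w \<bullet> (diag_mat d *v ?w)"
    by (simp only: cinner_inner[symmetric] cinner_adj)
  also have "\<dots> = (\<Sum>i\<in>UNIV. d i * (cmod (?w $ i))\<^sup>2)"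
    by (simp only: inner_vec_def diag inner_scaleR_right power2_norm_eq_inner)
  finally show ?thesis .
qed

lemma adj_unitary_norm:
  assumes "unitary U"
  shows "(\<Sum>i\<in>UNIV. (cmod ((adj U *v v) $ i))\<^sup>2) = v \<bullet> v"
  using quad_udiag[of v U "\<lambda>_. 1"] by (simp add: udiag_const[OF assms])

lemma quad_udiag_eigenvector:
  assumes "unitary U"
  shows "(U *v axis i 1) \<bullet> (udiag U d *v (U *v axis i 1)) = d i"
  unfolding quad_udiag unitary_mult_vec[OF assms]
  by (simp add: axis_def if_distrib[where f = "\<lambda>x. _ * (cmod x)\<^sup>2"] cong: if_cong)

text \<open>In the coordinates \<open>adj U *v v\<close> the form is a weighted sum of squares;
  testing it on the columns of \<open>U\<close> recovers the single eigenvalues. Unlike eigenvalues,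
  such form bounds can be added, which later controls the spectrum of a perturbed state.\<close>

lemma udiag_bounded_below_iff:
  assumes "unitary U"
  shows "(\<forall>v. a * (v \<bullet> v) \<le> v \<bullet> (udiag U d *v v)) \<longleftrightarrow> (\<forall>i. a \<le> d i)"
proof
  assume *: "\<forall>v. a * (v \<bullet> v) \<le> v \<bullet> (udiag U d *v v)"
  show "\<forall>i. a \<le> d i"
  proof
    fix i
    have "(U *v axis i 1) \<bullet> (U *v axis i 1) = 1"
      using quad_udiag_eigenvector[OF assms, of i "\<lambda>_. 1"] by (simp add: udiag_const[OF assms])
    then show "a \<le> d i"
      using *[rule_format, of "U *v axis i 1"] by (simp add: quad_udiag_eigenvector[OF assms])
  qed
next
  assume "\<forall>i. a \<le> d i"
  then show "\<forall>v. a * (v \<bullet> v) \<le> v \<bullet> (udiag U d *v v)"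
    unfolding quad_udiag adj_unitary_norm[OF assms, symmetric] sum_distrib_left
    by (auto intro!: sum_mono mult_right_mono)
qed

lemma spec_in_atLeast_iff:
  "A \<in> spec_in {a..} \<longleftrightarrow> A \<in> Herm \<and> (\<forall>v. a * (v \<bullet> v) \<le> v \<bullet> (A *v v))"
proof (cases "A \<in> Herm")
  case True
  then obtain U d where Ud: "unitary U" "A = udiag U d" by (rule Herm_udiag)
  have "A \<in> spec_in {a..} \<longleftrightarrow> (\<forall>v. a * (v \<bullet> v) \<le> v \<bullet> (A *v v))"
  proof
    assume "A \<in> spec_in {a..}"
    then show "\<forall>v. a * (v \<bullet> v) \<le> v \<bullet> (A *v v)"
      unfolding spec_in_def using udiag_bounded_below_iff by (fastforce simp del: split_paired_All)
  next
    assume "\<forall>v. a * (v \<bullet> v) \<le> v \<bullet> (A *v v)"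
    then show "A \<in> spec_in {a..}"
      unfolding spec_in_def using udiag_bounded_below_iff[OF Ud(1), of a d] Ud by blast
  qed
  with True show ?thesis by blast
qed (auto dest: spec_in_Herm)

lemma pos_semidef_iff_spec_in: "pos_semidef A \<longleftrightarrow> A \<in> spec_in {0..}"
  by (simp add: pos_semidef_def spec_in_atLeast_iff cinner_inner)

lemma pos_def_udiag_iff:
  assumes U: "unitary U"
  shows "pos_def (udiag U d) \<longleftrightarrow> range d \<subseteq> {0<..}"
proof
  assume *: "pos_def (udiag U d)"
  have "0 < d i" for i
  proof -
    have "adj U *v (U *v axis i 1) \<noteq> 0"
      by (simp add: unitary_mult_vec[OF U] axis_eq_0_iff)
    then have "U *v axis i 1 \<noteq> 0" by auto
    then have "0 < (U *v axis i 1) \<bullet> (udiag U d *v (U *v axis i 1))"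
      using * unfolding pos_def_def cinner_inner by blast
    then show ?thesis
      by (simp add: quad_udiag_eigenvector[OF U])
  qed
  then show "range d \<subseteq> {0<..}" by auto
next
  assume pos: "range d \<subseteq> {0<..}"
  \<comment> \<open>The spectrum is finite, so strict positivity gives a uniform positive lower
    bound.\<close>
  have "Min (range d) \<in> range d" by (rule Min_in) auto
  then have "0 < Min (range d)" using pos by blast
  moreover have "Min (range d) * (v \<bullet> v) \<le> v \<bullet> (udiag U d *v v)" for v
    using udiag_bounded_below_iff[OF U, of "Min (range d)" d] by simp
  ultimately have "0 < v \<bullet> (udiag U d *v v)" if "v \<noteq> 0" for v
    using that by (meson inner_gt_zero_iff less_le_trans mult_pos_pos)
  then show "pos_def (udiag U d)"
    by (simp add: pos_def_def udiag_Herm cinner_inner)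
qed

lemma pos_def_iff_spec_in: "pos_def A \<longleftrightarrow> A \<in> spec_in {0<..}"
proof
  assume "pos_def A"
  moreover from this obtain U d where "unitary U" "A = udiag U d"
    using Herm_udiag pos_def_def by metis
  ultimately show "A \<in> spec_in {0<..}"
    unfolding spec_in_def using pos_def_udiag_iff by blast
qed (auto simp: spec_in_def pos_def_udiag_iff)

lemma pos_def_imp_pos_semidef: "pos_def A \<Longrightarrow> pos_semidef A"
  unfolding pos_def_iff_spec_in pos_semidef_iff_spec_in
  by (rule subsetD[OF spec_in_mono[of "{0<..}" "{0..}"]]) auto

section \<open>Continuity of the functional calculus\<close>

lemma unitary_entry_le:
  assumes "unitary U"
  shows "cmod (U $ i $ j) \<le> 1"
proof -
  have "(cmod (U $ i $ j))\<^sup>2 \<le> (\<Sum>j\<in>UNIV. (cmod (U $ i $ j))\<^sup>2)"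
    by (rule member_le_sum) auto
  then show ?thesis
    by (simp add: unitary_row_sum[OF assms] abs_square_le_1)
qed

lemma bounded_vec_components:
  fixes S :: "('a::real_normed_vector ^ 'n) set"
  assumes "\<And>x i. x \<in> S \<Longrightarrow> norm (x $ i) \<le> B"
  shows "bounded S"
  unfolding bounded_iff
proof (intro exI ballI)
  fix x assume "x \<in> S"
  have "norm x \<le> (\<Sum>i\<in>UNIV. norm (x $ i))"
    unfolding norm_vec_def by (rule L2_set_le_sum) simp
  also have "\<dots> \<le> (\<Sum>i\<in>(UNIV::'n set). B)"
    by (intro sum_mono assms[OF \<open>x \<in> S\<close>])
  finally show "norm x \<le> (\<Sum>i\<in>(UNIV::'n set). B)" .
qed

lemma compact_unitary: "compact {U :: 'n::finite cmat. unitary U}"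
proof -
  have "bounded {U :: 'n cmat. unitary U}"
  proof (rule bounded_vec_components)
    fix U :: "'n cmat" and i assume "U \<in> {U. unitary U}"
    then have U: "unitary U" by simp
    have "norm (U $ i) \<le> (\<Sum>j\<in>UNIV. cmod (U $ i $ j))"
      unfolding norm_vec_def by (rule L2_set_le_sum) simp
    also have "\<dots> \<le> (\<Sum>j\<in>(UNIV::'n set). 1)"
      by (intro sum_mono unitary_entry_le U)
    finally show "norm (U $ i) \<le> (\<Sum>j\<in>(UNIV::'n set). 1)" .
  qed
  moreover have "closed {U :: 'n cmat. unitary U}"
    unfolding unitary_def vec_eq_iff matrix_matrix_mult_def adj_def mat_def vec_lambda_beta
    by (intro closed_Collect_conj closed_Collect_all closed_Collect_eq continuous_intros)
  ultimately show ?thesis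
    by (simp add: compact_eq_bounded_closed)
qed

lemma compact_vec_components:
  assumes "compact (S :: real set)"
  shows "compact {x :: real ^ 'n. \<forall>i. x $ i \<in> S}"
proof -
  obtain B where "\<And>s. s \<in> S \<Longrightarrow> norm s \<le> B"
    using compact_imp_bounded[OF assms] unfolding bounded_iff by blast
  then have "bounded {x :: real ^ 'n. \<forall>i. x $ i \<in> S}"
    by (intro bounded_vec_components) auto
  moreover have "closed ((\<lambda>x :: real ^ 'n. x $ i) -` S)" for i
    by (intro closed_vimage compact_imp_closed assms continuous_intros)
  then have "closed {x :: real ^ 'n. \<forall>i. x $ i \<in> S}"
    by (intro closed_Collect_all) (simp add: vimage_def)
  ultimately show ?thesis
    by (simp add: compact_eq_bounded_closed)
qed

lemma continuous_on_udiag: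
  assumes "continuous_on K u" "\<And>k. continuous_on K (\<lambda>x. d x k)"
  shows "continuous_on K (\<lambda>x. udiag (u x) (d x))"
proof -
  have "udiag (u x) (d x) = (\<chi> i j. \<Sum>k\<in>UNIV. u x $ i $ k * of_real (d x k) * cnj (u x $ j $ k))" for x
    by (simp add: vec_eq_iff udiag_nth)
  then show ?thesis
    by (simp only:) (intro continuous_intros assms)
qed

text \<open>Eigenvalues are stored as a vector rather than a function, which places the parameters
  in a Euclidean space where compact means closed and bounded.\<close>

abbreviation udiag_params :: "real set \<Rightarrow> ('n::finite cmat \<times> (real ^ 'n)) set" where
  "udiag_params S \<equiv> {U. unitary U} \<times> {x. \<forall>i. x $ i \<in> S}"

lemma spec_in_eq_image:
  "(spec_in S :: 'n::finite cmat set) = (\<lambda>(U, x). udiag U (($) x)) ` udiag_params S"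
proof
  show "(spec_in S :: 'n cmat set) \<subseteq> (\<lambda>(U, x). udiag U (($) x)) ` udiag_params S"
  proof
    fix A :: "'n cmat" assume "A \<in> spec_in S"
    then obtain U d where "unitary U" "range d \<subseteq> S" "A = udiag U d"
      by (auto simp: spec_in_def)
    moreover have "d = ($) (\<chi> i. d i)" by auto
    ultimately show "A \<in> (\<lambda>(U, x). udiag U (($) x)) ` udiag_params S"
      by (intro image_eqI[where x = "(U, \<chi> i. d i)"]) auto
  qed
qed (auto simp: spec_in_def)

lemma compact_spec_in:
  assumes "compact S"
  shows "compact (spec_in S)"
  unfolding spec_in_eq_image case_prod_beta
  by (intro compact_continuous_image compact_Times compact_unitary compact_vec_components assms
      continuous_on_udiag continuous_intros)

text \<open>The graph of \<open>herm_fun g\<close> over \<open>spec_in S\<close> is a continuous image of the compact set of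
  pairs of a unitary and a vector of eigenvalues, hence compact.\<close>

lemma continuous_on_herm_fun:
  assumes S: "compact S" and g: "continuous_on S g"
  shows "continuous_on (spec_in S) (herm_fun g :: 'n::finite cmat \<Rightarrow> 'n cmat)"
proof -
  let ?K = "udiag_params S :: ('n cmat \<times> (real ^ 'n)) set"
  let ?\<Phi> = "\<lambda>(U, x). (udiag U (($) x), udiag U (\<lambda>i. g (x $ i)))"
  have "compact (?\<Phi> ` ?K)"
    unfolding case_prod_beta
    by (intro compact_continuous_image compact_Times compact_unitary compact_vec_components S
        continuous_on_udiag continuous_on_Pair continuous_on_compose2[OF g] continuous_intros) auto
  moreover have graph: "?\<Phi> ` ?K = (\<lambda>A. (A, herm_fun g A)) ` spec_in S"
    unfolding spec_in_eq_image image_image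
    by (intro image_cong) (auto simp: herm_fun_udiag comp_def)
  ultimately have compact: "compact ((\<lambda>A. (A, herm_fun g A)) ` (spec_in S :: 'n cmat set))"
    by simp
  then have "compact (snd ` (\<lambda>A. (A, herm_fun g A)) ` (spec_in S :: 'n cmat set))"
    by (intro compact_continuous_image[OF _ compact] continuous_intros)
  then have T: "compact (herm_fun g ` (spec_in S :: 'n cmat set))"
    by (simp add: image_image)
  \<comment> \<open>A closed graph over a compact codomain yields continuity.\<close>
  have "closedin (top_of_set (spec_in S \<times> herm_fun g ` (spec_in S :: 'n cmat set)))
      ((\<lambda>A. (A, herm_fun g A)) ` spec_in S)"
    by (rule closed_subset) (auto intro: compact_imp_closed[OF compact])
  then show ?thesis
    using continuous_closed_graph_eq[OF T, of "herm_fun g" "spec_in S"] by blast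
qed

section \<open>The trace inner product\<close>

lemma hs_inner_sum: "hs_inner X Y = (\<Sum>i\<in>UNIV. \<Sum>j\<in>UNIV. Re (X $ i $ j * Y $ j $ i))"
  by (simp add: hs_inner_def trace_def matrix_matrix_mult_def)

lemma hs_inner_commute: "hs_inner X Y = hs_inner Y X"
  unfolding hs_inner_def by (subst trace_mul_sym) (rule refl)

lemma hs_inner_add_left: "hs_inner (X + Y) Z = hs_inner X Z + hs_inner Y Z"
proof -
  have "(X + Y) ** Z = X ** Z + Y ** Z"
    by (simp add: matrix_matrix_mult_def vec_eq_iff distrib_right sum.distrib)
  then show ?thesis by (simp add: hs_inner_def trace_add)
qed

lemma hs_inner_add_right: "hs_inner X (Y + Z) = hs_inner X Y + hs_inner X Z"
  by (metis hs_inner_add_left hs_inner_commute)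

lemma hs_inner_scaleR_left: "hs_inner (r *\<^sub>R X) Y = r * hs_inner X Y"
  by (simp add: hs_inner_sum sum_distrib_left algebra_simps)

lemma hs_inner_scaleR_right: "hs_inner X (r *\<^sub>R Y) = r * hs_inner X Y"
  by (metis hs_inner_scaleR_left hs_inner_commute)

lemma hs_inner_minus_left: "hs_inner (- X) Y = - hs_inner X Y"
  using hs_inner_scaleR_left[of "-1" X Y] by simp

lemma hs_inner_diff_left: "hs_inner (X - Y) Z = hs_inner X Z - hs_inner Y Z"
  using hs_inner_add_left[of X "- Y" Z] by (simp add: hs_inner_minus_left)

lemma hs_inner_diff_right: "hs_inner X (Y - Z) = hs_inner X Y - hs_inner X Z"
  by (metis hs_inner_diff_left hs_inner_commute)

lemmas hs_inner_linear = hs_inner_add_left hs_inner_add_right hs_inner_diff_left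
  hs_inner_diff_right hs_inner_scaleR_left hs_inner_scaleR_right

lemma hs_inner_mat_1: "hs_inner X (mat 1) = Re (trace X)"
  by (simp add: hs_inner_def)

lemma continuous_on_hs_inner:
  assumes "continuous_on S f" "continuous_on S g"
  shows "continuous_on S (\<lambda>x. hs_inner (f x) (g x))"
  unfolding hs_inner_sum by (intro continuous_intros assms)

lemma trace_scaleR: "trace (r *\<^sub>R A) = r *\<^sub>R trace (A :: 'n::finite cmat)"
  by (simp add: trace_def scaleR_sum_right)

text \<open>The transition probabilities between the columns of \<open>U\<close> and those of
  \<open>V\<close>: squared moduli of their inner products.\<close>

definition overlap :: "'n::finite cmat \<Rightarrow> 'n cmat \<Rightarrow> 'n \<Rightarrow> 'n \<Rightarrow> real" where
  "overlap U V i j = (cmod ((adj U ** V) $ i $ j))\<^sup>2"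

lemma overlap_nonneg [simp]: "0 \<le> overlap U V i j"
  by (simp add: overlap_def)

lemma overlap_row_sum:
  "unitary U \<Longrightarrow> unitary V \<Longrightarrow> (\<Sum>j\<in>UNIV. overlap U V i j) = 1"
  unfolding overlap_def by (intro unitary_row_sum unitary_mult unitary_adj)

lemma overlap_column_sum:
  "unitary U \<Longrightarrow> unitary V \<Longrightarrow> (\<Sum>i\<in>UNIV. overlap U V i j) = 1"
  unfolding overlap_def by (intro unitary_column_sum unitary_mult unitary_adj)

text \<open>Cyclicity of the trace gathers both unitaries into \<open>adj U ** V\<close>. Operators
  that need not commute are thereby paired through a scalar double sum over their
  eigenvalues.\<close>

lemma hs_inner_udiag:
  "hs_inner (udiag U d) (udiag V e) = (\<Sum>i\<in>UNIV. \<Sum>j\<in>UNIV. overlap U V i j * (d i * e j))"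
proof -
  let ?W = "adj U ** V"
  have "trace (udiag U d ** udiag V e) = trace ((diag_mat d ** ?W) ** (diag_mat e ** adj ?W))"
    unfolding udiag_def
    by (metis (no_types, opaque_lifting) adj_adj adj_mult matrix_mul_assoc trace_mul_sym)
  also have "\<dots> = (\<Sum>i\<in>UNIV. \<Sum>j\<in>UNIV. of_real (overlap U V i j * (d i * e j)))"
    unfolding trace_def matrix_matrix_mult_def[of "diag_mat d ** ?W"] vec_lambda_beta
    by (simp add: diag_mat_mult_left overlap_def complex_norm_square adj_def[of ?W] algebra_simps
        del: of_real_power)
  finally show ?thesis
    by (simp add: hs_inner_def)
qed

lemma hs_inner_udiag_same:
  assumes "unitary U"
  shows "hs_inner (udiag U d) (udiag U e) = (\<Sum>i\<in>UNIV. d i * e i)"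
  by (simp add: hs_inner_def udiag_mult trace_udiag assms)

section \<open>Density operators and relative entropy\<close>

lemma density_ops_udiag:
  assumes "\<sigma> \<in> density_ops"
  obtains U d where "unitary U" "\<sigma> = udiag U d" "range d \<subseteq> {0..1}" "(\<Sum>i\<in>UNIV. d i) = 1"
proof -
  from assms have "\<sigma> \<in> spec_in {0..}" and tr: "trace \<sigma> = 1"
    by (simp_all add: density_ops_def pos_semidef_iff_spec_in)
  then obtain U d where Ud: "unitary U" "\<sigma> = udiag U d" "range d \<subseteq> {0..}"
    by (auto simp: spec_in_def)
  then have nonneg: "0 \<le> d i" for i by auto
  have "complex_of_real (\<Sum>i\<in>UNIV. d i) = 1"
    using tr trace_udiag[OF Ud(1), of d] Ud(2) by simp
  then have sum: "(\<Sum>i\<in>UNIV. d i) = 1"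
    by (simp only: of_real_eq_1_iff)
  have "d i \<le> 1" for i
    using member_le_sum[of i UNIV d] nonneg sum by simp
  then have "range d \<subseteq> {0..1}" using nonneg by auto
  then show ?thesis
    using that Ud sum by blast
qed

lemma density_ops_subset_spec_in: "density_ops \<subseteq> spec_in {0..1}"
proof
  fix \<sigma> :: "'n::finite cmat" assume "\<sigma> \<in> density_ops"
  then show "\<sigma> \<in> spec_in {0..1}"
    by (rule density_ops_udiag) (auto simp: spec_in_def)
qed

text \<open>The tangent line at 1 lies below the convex function; concretely, the bound
  \<open>ln y \<le> y - 1\<close> is used at \<open>y = 1 / x\<close>.\<close>

lemma xlnx_ge: "x - 1 \<le> x * ln x" if "0 \<le> x" for x :: real
proof (cases "x = 0")
  case False
  then have "ln (1 / x) \<le> 1 / x - 1"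
    using that by (intro ln_le_minus_one) simp
  then have "x * (1 - 1 / x) \<le> x * ln x"
    using that False by (intro mult_left_mono) (simp_all add: ln_div)
  then show ?thesis
    using False by (simp add: algebra_simps)
qed simp

text \<open>The preceding tangent bound at \<open>x / y\<close>, scaled by \<open>y\<close>.\<close>

lemma rel_entropy_scalar_nonneg: "0 \<le> x * ln x - x * ln y - x + y" if "0 \<le> x" "0 < y" for x y :: real
proof -
  have "y * (x / y - 1) \<le> y * (x / y * ln (x / y))"
    using that by (intro mult_left_mono xlnx_ge) auto
  then show ?thesis
    using that by (cases "x = 0") (simp_all add: ln_div algebra_simps)
qed

text \<open>Klein's inequality: the overlaps are doubly stochastic, so the scalar inequality may be
  summed against them.\<close>

lemma rel_entropy_nonneg:
  assumes "\<sigma> \<in> density_ops" "\<tau> \<in> density_ops" "pos_def \<tau>"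
  shows "0 \<le> rel_entropy \<sigma> \<tau>"
proof -
  obtain U d where U: "unitary U" "\<sigma> = udiag U d" and d: "range d \<subseteq> {0..1}"
    and d1: "(\<Sum>i\<in>UNIV. d i) = 1"
    using assms(1) by (rule density_ops_udiag)
  obtain V e where V: "unitary V" "\<tau> = udiag V e" and e: "range e \<subseteq> {0<..}"
    using assms(3) by (auto simp: pos_def_iff_spec_in spec_in_def)
  have e1: "(\<Sum>i\<in>UNIV. e i) = 1"
    using assms(2) trace_udiag[OF V(1), of e] unfolding density_ops_def V(2)
    by (metis (mono_tags, lifting) mem_Collect_eq of_real_eq_1_iff)
  let ?w = "overlap U V"
  have row: "(\<Sum>i\<in>UNIV. \<Sum>j\<in>UNIV. ?w i j * f i) = (\<Sum>i\<in>UNIV. f i)" for f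
    by (simp add: sum_distrib_right[symmetric] overlap_row_sum U V)
  have col: "(\<Sum>i\<in>UNIV. \<Sum>j\<in>UNIV. ?w i j * f j) = (\<Sum>j\<in>UNIV. f j)" for f
    by (subst sum.swap) (simp add: sum_distrib_right[symmetric] overlap_column_sum U V)
  have "0 \<le> (\<Sum>i\<in>UNIV. \<Sum>j\<in>UNIV. ?w i j * (d i * ln (d i) - d i * ln (e j) - d i + e j))"
    using d e by (intro sum_nonneg mult_nonneg_nonneg rel_entropy_scalar_nonneg) (auto simp: image_subset_iff)
  also have "\<dots> = (\<Sum>i\<in>UNIV. \<Sum>j\<in>UNIV. ?w i j * (d i * ln (d i)))
      - (\<Sum>i\<in>UNIV. \<Sum>j\<in>UNIV. ?w i j * (d i * ln (e j)))
      - (\<Sum>i\<in>UNIV. \<Sum>j\<in>UNIV. ?w i j * d i) + (\<Sum>i\<in>UNIV. \<Sum>j\<in>UNIV. ?w i j * e j)"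
    by (simp add: distrib_left right_diff_distrib sum.distrib sum_subtractf)
  \<comment> \<open>The marginals of the overlaps turn the last two sums into the traces of
    \<open>\<sigma>\<close> and \<open>\<tau>\<close>; both are 1 and cancel.\<close>
  also have "\<dots> = rel_entropy \<sigma> \<tau>"
    unfolding row col d1 e1 rel_entropy_def hs_inner_diff_right U(2) V(2)
      herm_fun_udiag[OF U(1)] herm_fun_udiag[OF V(1)] hs_inner_udiag_same[OF U(1)]
    by (simp add: hs_inner_udiag)
  finally show ?thesis .
qed

lemma continuous_on_xlnx: "continuous_on {0..1} (\<lambda>x::real. x * ln x)"
proof (rule continuous_on_eq_continuous_within[THEN iffD2], rule ballI)
  fix x :: real assume x: "x \<in> {0..1}"
  show "continuous (at x within {0..1}) (\<lambda>x. x * ln x)"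
  proof (cases "x = 0")
    case True
    \<comment> \<open>The tangent bound at \<open>y\<close> itself only gives a limit of -1. Applied
      to \<open>q = sqrt y\<close> and multiplied by \<open>2 * q\<close>, it gives a lower bound
      that vanishes at 0.\<close>
    have lower: "2 * y - 2 * sqrt y \<le> y * ln y" if "y \<in> {0..1}" for y :: real
    proof -
      define q where "q = sqrt y"
      have q: "0 \<le> q" "y = q * q" using that by (simp_all add: q_def)
      have "q * (2 * (q - 1)) \<le> q * (2 * (q * ln q))"
        using q(1) xlnx_ge[of q] by (intro mult_left_mono) auto
      moreover have "q * (2 * (q * ln q)) = y * ln y"
        using q by (cases "q = 0") (simp_all add: ln_mult)
      ultimately show ?thesis
        unfolding q_def[symmetric] using q(2) by (simp only:) (simp add: right_diff_distrib)
    qed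
    have upper: "y * ln y \<le> 0" if "y \<in> {0..1}" for y :: real
      using that by (cases "y = 0") (auto intro: mult_nonneg_nonpos)
    have "((\<lambda>y::real. 2 * y - 2 * sqrt y) \<longlongrightarrow> 2 * 0 - 2 * sqrt 0) (at 0 within {0..1})"
      by (intro tendsto_intros)
    then have left: "((\<lambda>y::real. 2 * y - 2 * sqrt y) \<longlongrightarrow> 0) (at 0 within {0..1})"
      by simp
    have "((\<lambda>y::real. y * ln y) \<longlongrightarrow> 0) (at 0 within {0..1})"
    proof (rule tendsto_sandwich[OF _ _ left tendsto_const])
      show "\<forall>\<^sub>F y in at 0 within {0..1}. 2 * y - 2 * sqrt y \<le> y * ln y"
        using lower by (simp add: eventually_at_filter)
      show "\<forall>\<^sub>F y in at 0 within {0..1}. y * ln y \<le> (0::real)"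
        using upper by (simp add: eventually_at_filter)
    qed
    then show ?thesis
      using True by (simp add: continuous_within)
  next
    case False
    then show ?thesis
      using x by (intro continuous_intros) auto
  qed
qed

text \<open>Singular states lie outside the reach of continuity of \<open>mlog\<close>; the single
  function \<open>x * ln x\<close> is continuous up to 0, so the entropy is rewritten through
  it.\<close>

lemma hs_inner_mlog_self:
  assumes "\<sigma> \<in> Herm"
  shows "hs_inner \<sigma> (mlog \<sigma>) = Re (trace (herm_fun (\<lambda>x. x * ln x) \<sigma>))"
proof -
  obtain U d where "unitary U" "\<sigma> = udiag U d"
    using assms by (rule Herm_udiag)
  then show ?thesis
    by (simp add: herm_fun_udiag hs_inner_udiag_same trace_udiag)
qed

lemma continuous_on_neg_entropy:
  "continuous_on density_ops (\<lambda>\<sigma> :: 'n::finite cmat. hs_inner \<sigma> (mlog \<sigma>))"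
proof -
  have "continuous_on density_ops (herm_fun (\<lambda>x. x * ln x) :: 'n cmat \<Rightarrow> 'n cmat)"
    by (rule continuous_on_subset[OF continuous_on_herm_fun density_ops_subset_spec_in])
      (auto intro: continuous_on_xlnx)
  then have "continuous_on density_ops (\<lambda>\<sigma> :: 'n cmat. Re (trace (herm_fun (\<lambda>x. x * ln x) \<sigma>)))"
    unfolding trace_def by (intro continuous_intros)
  then show ?thesis
    by (rule continuous_on_eq)
      (auto simp: hs_inner_mlog_self density_ops_def pos_semidef_def)
qed

section \<open>The feasible set\<close>

lemma scaleR_matrix_vector: "(r *\<^sub>R A) *v v = r *\<^sub>R (A *v (v :: complex ^ 'n::finite))"
  by (simp add: vec_eq_iff matrix_vector_mult_def scaleR_sum_right)

lemma pos_def_add: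
  assumes "pos_semidef A" "pos_def B" "0 \<le> s" "0 < t"
  shows "pos_def (s *\<^sub>R A + t *\<^sub>R B)"
  using assms
  by (simp add: pos_semidef_def pos_def_def cinner_inner Herm_add Herm_scaleR
      matrix_vector_mult_add_rdistrib scaleR_matrix_vector inner_add_right
      add_nonneg_pos)

lemma feasible_diff_T_space:
  assumes "\<sigma> \<in> feasible H c k" "\<tau> \<in> feasible H c k"
  shows "\<sigma> - \<tau> \<in> T_space H k"
  using assms
  by (simp add: feasible_def density_ops_def pos_semidef_def T_space_def Herm_diff trace_sub
      hs_inner_diff_left)

lemma T_space_scaleR: "X \<in> T_space H k \<Longrightarrow> r *\<^sub>R X \<in> T_space H k"
  by (simp add: T_space_def Herm_scaleR trace_scaleR hs_inner_scaleR_left)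

lemma feasible_add_T_space:
  assumes "\<sigma> \<in> feasible H c k" "X \<in> T_space H k" "pos_semidef (\<sigma> + X)"
  shows "\<sigma> + X \<in> feasible H c k"
  using assms
  by (simp add: feasible_def density_ops_def T_space_def trace_add hs_inner_add_left)

text \<open>Nonnegative eigenvalues summing to 1 lie in \<open>{0..1}\<close>, so the feasible set
  is cut out of the compact \<open>spec_in {0..1}\<close> by closed linear conditions.\<close>

lemma compact_feasible: "compact (feasible H c k)"
proof -
  have "feasible H c k = spec_in {0..1} \<inter>
      {\<sigma>. trace \<sigma> = 1 \<and> (\<forall>j. j \<in> {1..k} \<longrightarrow> hs_inner \<sigma> (H j) = c j)}"
  proof (intro equalityI subsetI)
    fix \<sigma> assume "\<sigma> \<in> feasible H c k"
    then have "\<sigma> \<in> density_ops" "\<forall>j\<in>{1..k}. hs_inner \<sigma> (H j) = c j"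
      by (simp_all add: feasible_def)
    moreover from this have "\<sigma> \<in> spec_in {0..1}"
      using density_ops_subset_spec_in by blast
    ultimately show "\<sigma> \<in> spec_in {0..1} \<inter>
        {\<sigma>. trace \<sigma> = 1 \<and> (\<forall>j. j \<in> {1..k} \<longrightarrow> hs_inner \<sigma> (H j) = c j)}"
      by (simp add: density_ops_def)
  next
    fix \<sigma> assume \<sigma>: "\<sigma> \<in> spec_in {0..1} \<inter>
        {\<sigma>. trace \<sigma> = 1 \<and> (\<forall>j. j \<in> {1..k} \<longrightarrow> hs_inner \<sigma> (H j) = c j)}"
    then have "pos_semidef \<sigma>"
      unfolding pos_semidef_iff_spec_in
      by (intro subsetD[OF spec_in_mono[of "{0..1}" "{0..}"]]) auto
    with \<sigma> show "\<sigma> \<in> feasible H c k"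
      by (simp add: feasible_def density_ops_def)
  qed
  moreover have "closed {\<sigma>. trace \<sigma> = 1 \<and> (\<forall>j. j \<in> {1..k} \<longrightarrow> hs_inner \<sigma> (H j) = c j)}"
    unfolding trace_def
    by (intro closed_Collect_conj closed_Collect_all closed_Collect_imp closed_Collect_eq
        open_Collect_const continuous_on_hs_inner continuous_intros)
  ultimately show ?thesis
    by (simp add: compact_Int_closed compact_spec_in)
qed

section \<open>Minimisers of the entropic objective\<close>

definition entropic :: "'n::finite cmat \<Rightarrow> 'n cmat \<Rightarrow> real" where
  "entropic C \<sigma> = hs_inner \<sigma> (mlog \<sigma>) + hs_inner \<sigma> C"

lemma entropic_minimiser_exists:
  assumes "feasible H c k \<noteq> {}"
  shows "\<exists>\<sigma>. is_arg_min (entropic C) (\<lambda>\<sigma>. \<sigma> \<in> feasible H c k) \<sigma>"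
proof -
  have "continuous_on (feasible H c k) (entropic C)"
    unfolding entropic_def
    by (intro continuous_on_add continuous_on_hs_inner continuous_intros
        continuous_on_subset[OF continuous_on_neg_entropy]) (auto simp: feasible_def)
  from continuous_attains_inf[OF compact_feasible assms this] show ?thesis
    by (auto simp: is_arg_min_linorder)
qed

text \<open>Klein's inequality bounds \<open>hs_inner \<sigma> (mlog \<tau>)\<close> by
  \<open>hs_inner \<sigma> (mlog \<sigma>)\<close>. The logarithm is thus taken only at the positive
  definite \<open>\<tau>\<close>, while \<open>\<sigma>\<close> may be singular.\<close>

lemma entropic_variational_inequality:
  assumes min: "is_arg_min (entropic C) (\<lambda>\<sigma>. \<sigma> \<in> feasible H c k) \<sigma>"
    and \<tau>: "\<tau> \<in> feasible H c k" "pos_def \<tau>"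
  shows "0 \<le> hs_inner (\<tau> - \<sigma>) (mlog \<tau> + C)"
proof -
  have "\<sigma> \<in> feasible H c k"
    using min by (simp add: is_arg_min_def)
  then have "0 \<le> rel_entropy \<sigma> \<tau>"
    using \<tau> by (intro rel_entropy_nonneg) (simp_all add: feasible_def)
  moreover have "entropic C \<sigma> \<le> entropic C \<tau>"
    using min \<tau>(1) by (simp add: is_arg_min_linorder)
  ultimately show ?thesis
    by (simp add: entropic_def rel_entropy_def hs_inner_linear)
qed

text \<open>If \<open>v\<close> is a unit vector in the kernel of a singular minimiser \<open>\<sigma>\<close>, then the least eigenvalue
  of \<open>\<tau> = \<sigma> + t (\<rho> - \<sigma>)\<close> is at most \<open>\<langle>v, \<tau> v\<rangle> \<le> t\<close>, so \<open>Tr (\<rho> log \<tau>)\<close> tends to \<open>-\<infinity>\<close> as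
  \<open>t\<close> tends to \<open>0\<close>, against the variational inequality at \<open>\<tau>\<close>.\<close>

lemma entropic_minimiser_pos_def:
  assumes min: "is_arg_min (entropic C) (\<lambda>\<sigma>. \<sigma> \<in> feasible H c k) (\<sigma> :: 'n::finite cmat)"
    and \<rho>: "\<rho> \<in> feasible H c k" "pos_def \<rho>"
  shows "pos_def \<sigma>"
proof (rule ccontr)
  assume sing: "\<not> pos_def \<sigma>"
  have \<sigma>: "\<sigma> \<in> feasible H c k" using min by (simp add: is_arg_min_def)
  then have "\<sigma> \<in> density_ops" by (simp add: feasible_def)
  then obtain V e where V: "unitary V" "\<sigma> = udiag V e" and e: "range e \<subseteq> {0..1}"
    by (rule density_ops_udiag)
  have "\<not> range e \<subseteq> {0<..}"
    using sing V unfolding pos_def_iff_spec_in spec_in_def by blast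
  then obtain z where "\<not> 0 < e z"
    by (auto simp: image_subset_iff)
  moreover have "e z \<in> {0..1}"
    using e by blast
  ultimately have z: "e z = 0" by simp
  obtain R r where R: "unitary R" "\<rho> = udiag R r" and r_pos: "range r \<subseteq> {0<..}"
    using \<rho>(2) by (auto simp: pos_def_iff_spec_in spec_in_def)
  then have r: "r i > 0" for i by (auto simp: image_subset_iff)
  have "complex_of_real (\<Sum>i\<in>UNIV. r i) = 1"
    using \<rho>(1) R trace_udiag[OF R(1), of r] by (simp add: feasible_def density_ops_def)
  then have "(\<Sum>i\<in>UNIV. r i) = 1" by (simp only: of_real_eq_1_iff)
  then have r1: "r i \<le> 1" for i
    using member_le_sum[of i UNIV r] r by (simp add: less_imp_le)
  define p where "p = Min (range r)"
  have "p \<in> range r" unfolding p_def by (rule Min_in) auto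
  then have p: "0 < p" using r by auto
  have pr: "p \<le> r i" for i by (simp add: p_def)
  define K where "K = hs_inner (\<rho> - \<sigma>) C"
  define n where "n = real CARD('n)"
  \<comment> \<open>Chosen so that \<open>p * ln t = - (\<bar>K\<bar> + n)\<close>. This bounds
    \<open>hs_inner \<rho> (mlog \<tau>)\<close> from above, whereas the variational inequality and
    the entropy bound \<open>1 - n\<close> force it to be at least
    \<open>1 - n - \<bar>K\<bar>\<close>.\<close>
  define t where "t = exp (- ((\<bar>K\<bar> + n) / p))"
  have n: "n > 0" by (simp add: n_def)
  then have "\<bar>K\<bar> + n > 0" by linarith
  then have t: "0 < t" "t < 1" using p by (simp_all add: t_def)
  define \<tau> where "\<tau> = \<sigma> + t *\<^sub>R (\<rho> - \<sigma>)"
  have \<tau>_conv: "\<tau> = (1 - t) *\<^sub>R \<sigma> + t *\<^sub>R \<rho>"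
    by (simp add: \<tau>_def algebra_simps)
  have \<tau>_pos: "pos_def \<tau>"
    unfolding \<tau>_conv using \<open>\<sigma> \<in> density_ops\<close> \<rho>(2) t
    by (intro pos_def_add) (auto simp: density_ops_def)
  then have \<tau>: "\<tau> \<in> feasible H c k"
    unfolding \<tau>_def using \<sigma> \<rho>(1)
    by (intro feasible_add_T_space T_space_scaleR feasible_diff_T_space pos_def_imp_pos_semidef)
  then have "\<tau> \<in> density_ops" by (simp add: feasible_def)
  then obtain U d where U: "unitary U" "\<tau> = udiag U d" and d: "range d \<subseteq> {0..1}"
    and sum_d: "(\<Sum>i\<in>UNIV. d i) = 1"
    by (rule density_ops_udiag)
  from d have d0: "0 \<le> d i" and d1: "d i \<le> 1" for i by (auto simp: image_subset_iff)
  have d_pos: "0 < d i" for i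
    using \<tau>_pos by (auto simp: U pos_def_udiag_iff image_subset_iff)
  define m where "m = Min (range d)"
  have "m \<in> range d" unfolding m_def by (rule Min_in) auto
  then obtain a where a: "d a = m" by auto
  have md: "m \<le> d i" for i by (simp add: m_def)
  have "m \<le> t"
  proof -
    \<comment> \<open>The projector onto a kernel vector of \<open>\<sigma>\<close>. Against
      \<open>\<tau>\<close> it yields a weighted mean of the eigenvalues of \<open>\<tau>\<close>,
      hence at least \<open>m\<close>; the \<open>\<sigma>\<close> part vanishes and only
      \<open>t\<close> times a mean of the eigenvalues of \<open>\<rho>\<close> remains.\<close>
    define P where "P = udiag V (\<lambda>i. if i = z then 1 else 0)"
    have P: "hs_inner (udiag W f) P = (\<Sum>i\<in>UNIV. overlap W V i z * f i)" for W f
      unfolding P_def hs_inner_udiag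
      by (simp add: if_distrib[where f = "\<lambda>x. _ * x"] cong: if_cong)
    have "m = (\<Sum>i\<in>UNIV. overlap U V i z * m)"
      by (simp add: sum_distrib_right[symmetric] overlap_column_sum U V)
    also have "\<dots> \<le> hs_inner \<tau> P"
      unfolding U(2) P by (intro sum_mono mult_left_mono md) simp
    also have "\<dots> = t * hs_inner \<rho> P"
    proof -
      have "hs_inner \<sigma> P = 0"
        by (simp add: V P_def hs_inner_udiag_same z if_distrib[where f = "\<lambda>x. _ * x"] cong: if_cong)
      then show ?thesis by (simp add: \<tau>_conv hs_inner_linear)
    qed
    also have "hs_inner \<rho> P \<le> (\<Sum>i\<in>UNIV. overlap R V i z * 1)"
      unfolding R(2) P by (intro sum_mono mult_left_mono r1) simp
    also have "\<dots> = 1"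
      by (simp add: overlap_column_sum R V)
    finally show ?thesis using t by simp
  qed
  have "hs_inner \<rho> (mlog \<tau>) \<le> p * ln t"
  proof -
    \<comment> \<open>All logarithms are nonpositive, so lowering each \<open>r i\<close> to
      \<open>p\<close> and then dropping every term except that of the least eigenvalue can only
      increase the sum.\<close>
    have ln_d: "ln (d j) \<le> 0" for j
      using d_pos[of j] d1 by simp
    have "hs_inner \<rho> (mlog \<tau>) = (\<Sum>i\<in>UNIV. \<Sum>j\<in>UNIV. overlap R U i j * (r i * ln (d j)))"
      by (simp add: U R herm_fun_udiag hs_inner_udiag)
    also have "\<dots> \<le> (\<Sum>i\<in>UNIV. \<Sum>j\<in>UNIV. overlap R U i j * (p * ln (d j)))"
      by (intro sum_mono mult_left_mono mult_right_mono_neg pr ln_d) simp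
    also have "\<dots> = (\<Sum>j\<in>UNIV. p * ln (d j))"
      by (subst sum.swap) (simp add: sum_distrib_right[symmetric] overlap_column_sum U R)
    also have "\<dots> = p * ln (d a) + (\<Sum>j\<in>UNIV - {a}. p * ln (d j))"
      by (rule sum.remove) auto
    also have "\<dots> \<le> p * ln (d a)"
      using p ln_d by (simp add: sum_nonpos mult_nonneg_nonpos)
    also have "\<dots> \<le> p * ln t"
      using p \<open>m \<le> t\<close> a d_pos[of a] by simp
    finally show ?thesis .
  qed
  moreover have "1 - n \<le> hs_inner \<tau> (mlog \<tau>)"
  proof -
    have "(\<Sum>i\<in>UNIV. d i) - n = (\<Sum>i\<in>UNIV. d i - 1)"
      by (simp add: sum_subtractf n_def)
    also have "\<dots> \<le> (\<Sum>i\<in>UNIV. d i * ln (d i))"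
      by (intro sum_mono xlnx_ge d0)
    also have "\<dots> = hs_inner \<tau> (mlog \<tau>)"
      by (simp add: U herm_fun_udiag hs_inner_udiag_same)
    finally have "(\<Sum>i\<in>UNIV. d i) - n \<le> hs_inner \<tau> (mlog \<tau>)" .
    then show ?thesis by (simp add: sum_d)
  qed
  moreover have "- \<bar>K\<bar> \<le> hs_inner \<rho> (mlog \<tau>) - hs_inner \<tau> (mlog \<tau>)"
  proof -
    have "0 \<le> hs_inner (\<tau> - \<sigma>) (mlog \<tau> + C)"
      by (rule entropic_variational_inequality[OF min \<tau> \<tau>_pos])
    then have "0 \<le> t * (hs_inner (\<rho> - \<sigma>) (mlog \<tau>) + K)"
      by (simp add: \<tau>_def K_def hs_inner_linear algebra_simps)
    then have "- K \<le> hs_inner (\<rho> - \<sigma>) (mlog \<tau>)"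
      using t by (simp add: zero_le_mult_iff)
    \<comment> \<open>Scaling by \<open>1 - t\<close> turns \<open>\<rho> - \<sigma>\<close> into
      \<open>\<rho> - \<tau>\<close>, trading \<open>hs_inner \<sigma> (mlog \<tau>)\<close> for
      \<open>hs_inner \<tau> (mlog \<tau>)\<close>, which has the lower bound
      \<open>1 - n\<close>.\<close>
    then have "(1 - t) * - K \<le> (1 - t) * hs_inner (\<rho> - \<sigma>) (mlog \<tau>)"
      using t by (intro mult_left_mono) auto
    moreover have "(1 - t) * hs_inner (\<rho> - \<sigma>) (mlog \<tau>)
        = hs_inner \<rho> (mlog \<tau>) - hs_inner \<tau> (mlog \<tau>)"
    proof -
      have "(1 - t) *\<^sub>R (\<rho> - \<sigma>) = \<rho> - \<tau>" by (simp add: \<tau>_conv algebra_simps)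
      then show ?thesis by (metis hs_inner_scaleR_left hs_inner_diff_left)
    qed
    moreover have "(1 - t) * K \<le> (1 - t) * \<bar>K\<bar>" "(1 - t) * \<bar>K\<bar> \<le> \<bar>K\<bar>"
      using t by (simp_all add: mult_left_mono mult_left_le_one_le)
    ultimately show ?thesis by simp
  qed
  moreover have "p * ln t = - (\<bar>K\<bar> + n)"
    using p by (simp add: t_def)
  ultimately show False by simp
qed

text \<open>For small positive \<open>t\<close> the state \<open>\<sigma> + t *\<^sub>R X\<close> is
  feasible and positive definite. The variational inequality there can be divided by
  \<open>t\<close>, and continuity of \<open>mlog\<close> along the segment permits the limit
  \<open>t\<close> to 0.\<close>

lemma entropic_first_order_ineq:
  assumes min: "is_arg_min (entropic C) (\<lambda>\<sigma>. \<sigma> \<in> feasible H c k) (\<sigma> :: 'n::finite cmat)"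
    and "pos_def \<sigma>" and X: "X \<in> T_space H k"
  shows "0 \<le> hs_inner X (mlog \<sigma> + C)"
proof -
  have \<sigma>: "\<sigma> \<in> feasible H c k" using min by (simp add: is_arg_min_def)
  obtain V e where V: "unitary V" "\<sigma> = udiag V e" and e_pos: "range e \<subseteq> {0<..}"
    using \<open>pos_def \<sigma>\<close> by (auto simp: pos_def_iff_spec_in spec_in_def)
  then have e: "e i > 0" for i by (auto simp: image_subset_iff)
  define p where "p = Min (range e)"
  have "p \<in> range e" unfolding p_def by (rule Min_in) auto
  then have p: "0 < p" using e by auto
  have \<sigma>_ge: "p * (v \<bullet> v) \<le> v \<bullet> (\<sigma> *v v)" for v
    using udiag_bounded_below_iff[OF V(1), of p e] by (simp add: V(2) p_def)
  have "X \<in> Herm" using X by (simp add: T_space_def)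
  then obtain W x where W: "unitary W" "X = udiag W x" by (rule Herm_udiag)
  define B where "B = (\<Sum>i\<in>UNIV. \<bar>x i\<bar>)"
  have "B \<ge> 0" by (simp add: B_def sum_nonneg)
  have "- B \<le> x i" for i
    using member_le_sum[of i UNIV "\<lambda>i. \<bar>x i\<bar>"] by (simp add: B_def)
  then have X_ge: "- B * (v \<bullet> v) \<le> v \<bullet> (X *v v)" for v
    using udiag_bounded_below_iff[OF W(1), of "- B" x] W(2) by blast
  \<comment> \<open>With \<open>B\<close> bounding the eigenvalues of \<open>X\<close> in modulus, a
    step of at most \<open>\<delta>\<close> consumes no more than half of the spectral gap
    \<open>p\<close> of \<open>\<sigma>\<close>. The \<open>+ 1\<close> covers
    \<open>B = 0\<close>.\<close>
  define \<delta> where "\<delta> = p / (2 * (B + 1))"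
  have \<delta>: "0 < \<delta>" using p \<open>B \<ge> 0\<close> by (simp add: \<delta>_def)
  have tB: "t * B \<le> p / 2" if "t \<le> \<delta>" "0 \<le> t" for t
  proof -
    have "t * B \<le> \<delta> * (B + 1)"
      using that \<open>B \<ge> 0\<close> by (intro mult_mono) auto
    also have "\<dots> = p / 2"
      using \<open>B \<ge> 0\<close> by (simp add: \<delta>_def field_simps)
    finally show ?thesis .
  qed
  have spec: "\<sigma> + t *\<^sub>R X \<in> spec_in {p / 2..}" if "t \<in> {0..\<delta>}" for t
    unfolding spec_in_atLeast_iff
  proof (intro conjI allI)
    show "\<sigma> + t *\<^sub>R X \<in> Herm"
      by (simp add: Herm_add Herm_scaleR \<open>X \<in> Herm\<close> V(2) udiag_Herm)
    fix v
    have "t * (- B * (v \<bullet> v)) \<le> t * (v \<bullet> (X *v v))"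
      using that X_ge by (intro mult_left_mono) auto
    moreover have "t * B * (v \<bullet> v) \<le> p / 2 * (v \<bullet> v)"
      using that by (intro mult_right_mono tB) auto
    ultimately show "p / 2 * (v \<bullet> v) \<le> v \<bullet> ((\<sigma> + t *\<^sub>R X) *v v)"
      using \<sigma>_ge[of v]
      by (simp add: matrix_vector_mult_add_rdistrib scaleR_matrix_vector
          inner_add_right algebra_simps)
  qed
  have pd: "pos_def (\<sigma> + t *\<^sub>R X)" if "t \<in> {0..\<delta>}" for t
    unfolding pos_def_iff_spec_in
    by (rule subsetD[OF spec_in_mono spec[OF that]]) (use p in auto)
  have feas: "\<sigma> + t *\<^sub>R X \<in> feasible H c k" if "t \<in> {0..\<delta>}" for t
    using \<sigma> X pd[OF that] by (intro feasible_add_T_space T_space_scaleR pos_def_imp_pos_semidef)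
  \<comment> \<open>Unit trace supplies the upper end, giving a compact spectral interval away from
    0 on which \<open>ln\<close> is continuous.\<close>
  have spec1: "\<sigma> + t *\<^sub>R X \<in> spec_in {p / 2..1}" if t: "t \<in> {0..\<delta>}" for t
  proof -
    have "\<sigma> + t *\<^sub>R X \<in> density_ops"
      using feas[OF t] by (simp add: feasible_def)
    then obtain U d where U: "unitary U" "\<sigma> + t *\<^sub>R X = udiag U d" and d: "range d \<subseteq> {0..1}"
      by (rule density_ops_udiag)
    have "p / 2 \<le> d i" for i
      using spec[OF t] udiag_bounded_below_iff[OF U(1), of "p / 2" d]
      unfolding spec_in_atLeast_iff U(2) by blast
    with d have "range d \<subseteq> {p / 2..1}" by (auto simp: image_subset_iff)
    with U show ?thesis unfolding spec_in_def by blast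
  qed
  define L where "L t = hs_inner X (mlog (\<sigma> + t *\<^sub>R X) + C)" for t
  have "continuous_on {p / 2..1} ln"
    using p by (intro continuous_intros) auto
  then have mlog: "continuous_on (spec_in {p / 2..1}) (mlog :: 'n cmat \<Rightarrow> 'n cmat)"
    by (intro continuous_on_herm_fun) auto
  have "continuous_on {0..\<delta>} L"
    unfolding L_def
    by (intro continuous_on_hs_inner continuous_intros continuous_on_compose2[OF mlog])
      (use spec1 in auto)
  then have "continuous_on (closure {0<..\<delta>}) L"
    using \<delta> by simp
  moreover have "0 \<le> L t" if "t \<in> {0<..\<delta>}" for t
  proof -
    have t: "0 < t" "t \<in> {0..\<delta>}" using that by auto
    have "0 \<le> hs_inner (\<sigma> + t *\<^sub>R X - \<sigma>) (mlog (\<sigma> + t *\<^sub>R X) + C)"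
      by (rule entropic_variational_inequality[OF min feas[OF t(2)] pd[OF t(2)]])
    then show ?thesis
      using t(1) by (simp add: L_def hs_inner_scaleR_left zero_le_mult_iff)
  qed
  ultimately have "0 \<le> L 0"
    using \<delta> by (intro continuous_ge_on_closure[of "{0<..\<delta>}" L 0 0]) auto
  then show ?thesis by (simp add: L_def)
qed

text \<open>The tangent space contains \<open>- X\<close> along with \<open>X\<close>, so the
  one-sided inequality becomes an equality.\<close>

lemma entropic_first_order:
  assumes "is_arg_min (entropic C) (\<lambda>\<sigma>. \<sigma> \<in> feasible H c k) \<sigma>"
    and "\<rho> \<in> feasible_pos H c k" and X: "X \<in> T_space H k"
  shows "hs_inner X (mlog \<sigma> + C) = 0"
proof -
  have "pos_def \<sigma>"
    using assms by (auto simp: feasible_pos_def intro: entropic_minimiser_pos_def)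
  then have "0 \<le> hs_inner Y (mlog \<sigma> + C)" if "Y \<in> T_space H k" for Y
    using assms(1) that by (intro entropic_first_order_ineq)
  from this[OF X] this[OF T_space_scaleR[OF X, of "-1"]] show ?thesis
    by (simp add: hs_inner_scaleR_left hs_inner_minus_left)
qed

section \<open>The two maps\<close>

text \<open>Normalising the exponential divides its eigenvalues by the partition function
  \<open>Z\<close>, which shifts the logarithm by \<open>ln Z\<close> times the identity. On
  trace-one operators such a shift adds a constant to the relative entropy.\<close>

lemma mlog_F3:
  assumes "\<rho> \<in> Herm" "\<Omega> \<rho> \<in> Herm"
  obtains r where "mlog (F3 \<Omega> \<gamma> \<rho>) = mlog \<rho> - (1 / \<gamma>) *\<^sub>R \<Omega> \<rho> - r *\<^sub>R mat 1"
proof -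
  let ?A = "mlog \<rho> - (1 / \<gamma>) *\<^sub>R \<Omega> \<rho>"
  have "?A \<in> Herm"
    by (intro Herm_diff Herm_scaleR herm_fun_Herm assms)
  then obtain U d where U: "unitary U" "?A = udiag U d" by (rule Herm_udiag)
  define Z where "Z = (\<Sum>i\<in>UNIV. exp (d i))"
  have Z: "Z > 0" unfolding Z_def by (intro sum_pos) auto
  have "mexp ?A = udiag U (\<lambda>i. exp (d i))"
    by (simp add: U herm_fun_udiag comp_def)
  then have "F3 \<Omega> \<gamma> \<rho> = udiag U (\<lambda>i. exp (d i) / Z)"
    by (simp add: F3_def trace_udiag U(1) Z_def udiag_scaleR)
  then have "mlog (F3 \<Omega> \<gamma> \<rho>) = udiag U (\<lambda>i. d i + - ln Z)"
    using Z by (simp add: herm_fun_udiag U(1) comp_def ln_div)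
  also have "\<dots> = udiag U d + udiag U (\<lambda>_. - ln Z)"
    by (rule udiag_add[symmetric])
  also have "\<dots> = ?A - ln Z *\<^sub>R mat 1"
    by (simp add: U(2) udiag_const[OF U(1)])
  finally show ?thesis by (rule that)
qed

text \<open>\<open>arg_min_on\<close> is a choice from the set of minimisers. Objectives that order
  \<open>M\<close> alike have the same minimisers, hence the same chosen element.\<close>

lemma arg_min_on_cong:
  fixes f g :: "'a \<Rightarrow> real"
  assumes "\<And>x y. x \<in> M \<Longrightarrow> y \<in> M \<Longrightarrow> f y < f x \<longleftrightarrow> g y < g x"
  shows "arg_min_on f M = arg_min_on g M"
proof -
  have "is_arg_min f (\<lambda>x. x \<in> M) = is_arg_min g (\<lambda>x. x \<in> M)"
    using assms by (auto simp: is_arg_min_def fun_eq_iff)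
  then show ?thesis by (simp add: arg_min_on_def arg_min_def)
qed

lemma T_AB_eq_entropic:
  assumes "\<rho> \<in> Herm" "\<Omega> \<rho> \<in> Herm"
  shows "T_AB (feasible H c k) \<Omega> \<gamma> \<rho>
    = arg_min_on (entropic ((1 / \<gamma>) *\<^sub>R \<Omega> \<rho> - mlog \<rho>)) (feasible H c k)"
  unfolding T_AB_def
proof (rule arg_min_on_cong)
  obtain r where r: "mlog (F3 \<Omega> \<gamma> \<rho>) = mlog \<rho> - (1 / \<gamma>) *\<^sub>R \<Omega> \<rho> - r *\<^sub>R mat 1"
    using assms by (rule mlog_F3)
  have *: "rel_entropy \<sigma> (F3 \<Omega> \<gamma> \<rho>) = entropic ((1 / \<gamma>) *\<^sub>R \<Omega> \<rho> - mlog \<rho>) \<sigma> + r"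
    if "\<sigma> \<in> feasible H c k" for \<sigma>
    using that
    by (simp add: rel_entropy_def entropic_def r hs_inner_linear hs_inner_mat_1 feasible_def
        density_ops_def)
  fix \<sigma> \<tau> assume "\<sigma> \<in> feasible H c k" "\<tau> \<in> feasible H c k"
  then show "rel_entropy \<tau> (F3 \<Omega> \<gamma> \<rho>) < rel_entropy \<sigma> (F3 \<Omega> \<gamma> \<rho>) \<longleftrightarrow>
      entropic ((1 / \<gamma>) *\<^sub>R \<Omega> \<rho> - mlog \<rho>) \<tau> < entropic ((1 / \<gamma>) *\<^sub>R \<Omega> \<rho> - mlog \<rho>) \<sigma>"
    by (simp add: *)
qed

lemma T_MD_eq_entropic:
  assumes "\<gamma> > 0"
  shows "T_MD M grad \<gamma> \<rho> = arg_min_on (entropic ((1 / \<gamma>) *\<^sub>R grad \<rho> - mlog \<rho>)) M"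
  unfolding T_MD_def
proof (rule arg_min_on_cong)
  have *: "hs_inner \<sigma> (grad \<rho>) + \<gamma> * rel_entropy \<sigma> \<rho>
      = \<gamma> * entropic ((1 / \<gamma>) *\<^sub>R grad \<rho> - mlog \<rho>) \<sigma>" for \<sigma>
    using assms by (simp add: rel_entropy_def entropic_def hs_inner_linear algebra_simps)
  show "hs_inner \<tau> (grad \<rho>) + \<gamma> * rel_entropy \<tau> \<rho> < hs_inner \<sigma> (grad \<rho>) + \<gamma> * rel_entropy \<sigma> \<rho> \<longleftrightarrow>
      entropic ((1 / \<gamma>) *\<^sub>R grad \<rho> - mlog \<rho>) \<tau> < entropic ((1 / \<gamma>) *\<^sub>R grad \<rho> - mlog \<rho>) \<sigma>" for \<sigma> \<tau>
    unfolding * using assms by simp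
qed

lemma entropic_arg_min_eq_iff:
  assumes \<rho>: "\<rho> \<in> feasible_pos H c k" and "A \<in> Herm" "B \<in> Herm"
  shows "arg_min_on (entropic A) (feasible H c k) = arg_min_on (entropic B) (feasible H c k)
    \<longleftrightarrow> A - B \<in> N_space H k"
proof
  let ?M = "feasible H c k"
  assume eq: "arg_min_on (entropic A) ?M = arg_min_on (entropic B) ?M"
  define \<sigma> where "\<sigma> = arg_min_on (entropic A) ?M"
  have "?M \<noteq> {}" using \<rho> by (auto simp: feasible_pos_def)
  \<comment> \<open>Existence guarantees that the chosen element really is a minimiser, so the
    first-order condition applies to it.\<close>
  then have min: "is_arg_min (entropic C) (\<lambda>\<sigma>. \<sigma> \<in> ?M) (arg_min_on (entropic C) ?M)" for C
    unfolding arg_min_on_def arg_min_def by (rule someI_ex[OF entropic_minimiser_exists])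
  have "hs_inner (A - B) X = 0" if "X \<in> T_space H k" for X
  proof -
    have "hs_inner X (mlog \<sigma> + A) = 0" "hs_inner X (mlog \<sigma> + B) = 0"
      using entropic_first_order[OF min \<rho> that, where C = A]
        entropic_first_order[OF min \<rho> that, where C = B] eq by (simp_all add: \<sigma>_def)
    then show ?thesis
      by (simp add: hs_inner_commute[of _ X] hs_inner_linear)
  qed
  then show "A - B \<in> N_space H k"
    using assms by (simp add: N_space_def Herm_diff)
next
  assume N: "A - B \<in> N_space H k"
  show "arg_min_on (entropic A) (feasible H c k) = arg_min_on (entropic B) (feasible H c k)"
  proof (rule arg_min_on_cong)
    fix \<sigma> \<tau> assume "\<sigma> \<in> feasible H c k" "\<tau> \<in> feasible H c k"
    then have "hs_inner (A - B) (\<tau> - \<sigma>) = 0"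
      using N feasible_diff_T_space[of \<tau> H c k \<sigma>] by (simp add: N_space_def)
    then have "entropic A \<tau> - entropic A \<sigma> = entropic B \<tau> - entropic B \<sigma>"
      by (simp add: hs_inner_commute[of A] hs_inner_commute[of B] entropic_def hs_inner_linear)
    then show "entropic A \<tau> < entropic A \<sigma> \<longleftrightarrow> entropic B \<tau> < entropic B \<sigma>"
      by linarith
  qed
qed

lemma N_space_scaleR_iff:
  assumes "r \<noteq> 0"
  shows "r *\<^sub>R Y \<in> N_space H k \<longleftrightarrow> Y \<in> N_space H k"
  using assms by (simp add: N_space_def Herm_def adj_scaleR hs_inner_scaleR_left)

theorem theorem4:
  fixes H :: "nat \<Rightarrow> complex ^ 'n::finite ^ 'n"
    and c :: "nat \<Rightarrow> real"
    and k :: nat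
    and \<Omega> grad :: "complex ^ 'n ^ 'n \<Rightarrow> complex ^ 'n ^ 'n"
    and \<gamma> :: real
  assumes "\<forall>j\<in>{1..k}. H j \<in> Herm"
    and "inj_on H {1..k}"
    and "mat 1 \<notin> H ` {1..k}"
    and "independent (insert (mat 1) (H ` {1..k}))"
    and "feasible_pos H c k \<noteq> {}"
    and "\<forall>\<rho>\<in>density_ops. \<Omega> \<rho> \<in> Herm"
    and "continuous_on density_ops \<Omega>"
    and "\<gamma> > 0"
    and "\<forall>\<rho>\<in>feasible_pos H c k. is_gradient (objective \<Omega>) (feasible H c k) \<rho> (grad \<rho>)"
  shows "\<forall>\<rho>\<in>feasible_pos H c k.
           T_AB (feasible H c k) \<Omega> \<gamma> \<rho> = T_MD (feasible H c k) grad \<gamma> \<rho>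
             \<longleftrightarrow> \<Omega> \<rho> - grad \<rho> \<in> N_space H k"
proof
  fix \<rho> assume \<rho>: "\<rho> \<in> feasible_pos H c k"
  then have "\<rho> \<in> density_ops" by (simp add: feasible_pos_def feasible_def)
  then have Herm: "\<rho> \<in> Herm" "\<Omega> \<rho> \<in> Herm"
    using assms(6) by (auto simp: density_ops_def pos_semidef_def)
  have grad: "grad \<rho> \<in> Herm"
    using assms(9) \<rho> by (simp add: is_gradient_def)
  let ?A = "(1 / \<gamma>) *\<^sub>R \<Omega> \<rho> - mlog \<rho>" and ?B = "(1 / \<gamma>) *\<^sub>R grad \<rho> - mlog \<rho>"
  have "T_AB (feasible H c k) \<Omega> \<gamma> \<rho> = T_MD (feasible H c k) grad \<gamma> \<rho> \<longleftrightarrow> ?A - ?B \<in> N_space H k"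
    unfolding T_AB_eq_entropic[where \<Omega> = \<Omega> and \<rho> = \<rho>, OF Herm] T_MD_eq_entropic[OF \<open>\<gamma> > 0\<close>]
    by (intro entropic_arg_min_eq_iff[OF \<rho>] Herm_diff Herm_scaleR herm_fun_Herm Herm grad)
  also have "?A - ?B = (1 / \<gamma>) *\<^sub>R (\<Omega> \<rho> - grad \<rho>)"
    by (simp add: algebra_simps)
  also have "\<dots> \<in> N_space H k \<longleftrightarrow> \<Omega> \<rho> - grad \<rho> \<in> N_space H k"
    using \<open>\<gamma> > 0\<close> by (intro N_space_scaleR_iff) simp
  finally show "T_AB (feasible H c k) \<Omega> \<gamma> \<rho> = T_MD (feasible H c k) grad \<gamma> \<rho>
      \<longleftrightarrow> \<Omega> \<rho> - grad \<rho> \<in> N_space H k" .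
qed

end
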